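(* Let $\Gamma$ be finitely generated and virtually $(\mathcal H,F)$-indicable. Let $C,W>0$ and $\varepsilon\in[1,2)$. Then the connective constant $(\phi,\ell)\mapsto\mu_{\phi,\ell}$ is a continuous function on the space $\Phi\circ\Lambda_\varepsilon(C,W)$ endowed with the distance function $$D_{\sup}\bigl((\phi,\ell_1),(\psi,\ell_2)\bigr)=\sup_\gamma\left|\frac{\phi(\gamma)-\psi(\gamma)}{\phi(\gamma)+\psi(\gamma)}\right|+\sup_\gamma\left|\frac{\ell_1(\gamma)-\ell_2(\gamma)}{\ell_1(\gamma)+\ell_2(\gamma)}\right|,$$ where both suprema are over $\gamma\in\mathrm{supp}(\phi)\cup\mathrm{supp}(\psi)$.
   Context: $\Gamma$ is virtually $(\mathcal H,F)$-indicable if $\mathcal H\trianglelefteq\Gamma$ has finite index and $F:\mathcal H\to\mathbb Z$ is a surjective homomorphism. $\Phi$: set of $\phi:\Gamma\to[0,\infty)$ with $\phi(\mathrm{id})=0$, $\phi(\gamma^{-1})=\phi(\gamma)$, $\sum_\gamma\phi(\gamma)<\infty$, and $\mathrm{supp}(\phi)=\{\gamma:\phi(\gamma)>0\}$ generating $\Gamma$. $K_\phi$: graph on $\Gamma$ with edges $\langle u,v\rangle$, $u^{-1}v\in\mathrm{supp}(\phi)$. A strong graph height function on $K_\phi$ is a pair $(h,\mathcal H)$ with $\mathcal H$ acting by left multiplication, $h:\Gamma\to\mathbb Z$, $h(\mathrm{id})=0$, $h(\alpha v)-h(\alpha u)=h(v)-h(u)$ for $\alpha\in\mathcal H$, and every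 vertex has $K_\phi$-neighbours of strictly smaller and strictly larger height; the paper fixes such a function $(h_F,\mathcal H)$ constructed from $F$. $\Lambda$: set of $\ell:\Gamma\to(0,\infty)$ with $\ell(\gamma^{-1})=\ell(\gamma)$, $\inf\ell>0$. $\Lambda_\varepsilon(C,\phi)$: set of $\ell\in\Lambda$ with $|h_F(u)-h_F(v)|\le C[\ell(u^{-1}v)]^\varepsilon$ whenever $\phi(u^{-1}v)>0$. SAWs on the complete graph on $\Gamma$ are sequences $\pi=(\pi_0,\dots,\pi_n)$ of distinct elements, with weight $w_\phi(\pi)=\prod_i\phi(\pi_{i-1}^{-1}\pi_i)$ and $\ell$-length $\ell(\pi)=\sum_i\ell(\pi_{i-1}^{-1}\pi_i)$; $\sigma_{m,c}$ is the set of SAWs from $\mathrm{id}$ with $m\le\ell(\pi)<m+c$, and for $c$ sufficiently large the connective constant $\mu_{\phi,\ell}=\limsup_{m\to\infty}\bigl(\sum_{\pi\in\sigma_{m,c}}w_\phi(\pi)\bigr)^{1/m}$ is independent of $c$. $\Phi\circ\Lambda_\varepsilon(C,W)$ is the set of pairs $(\phi,\ell)$ with $\phi\in\Phi$, $\ell\in\Lambda_\varepsilon(C,\phi)$ and $\mu_{\phi,\ell}\le W$. *)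

theory Defs
  imports "HOL-Analysis.Analysis" "HOL-Algebra.Algebra"
begin

definition finitely_generated :: "('a, 'b) monoid_scheme \<Rightarrow> bool" where
  "finitely_generated G \<longleftrightarrow> (\<exists>S. finite S \<and> S \<subseteq> carrier G \<and> generate G S = carrier G)"

definition virtually_indicable ::
    "('a, 'b) monoid_scheme \<Rightarrow> 'a set \<Rightarrow> ('a \<Rightarrow> int) \<Rightarrow> bool" where
  "virtually_indicable G H F \<longleftrightarrow>
     H \<lhd> G \<and> finite (rcosets\<^bsub>G\<^esub> H) \<and> F \<in> epi (G\<lparr>carrier := H\<rparr>) integer_group"

definition supp :: "('a, 'b) monoid_scheme \<Rightarrow> ('a \<Rightarrow> real) \<Rightarrow> 'a set" where
  "supp G \<phi> = {\<gamma> \<in> carrier G. \<phi> \<gamma> > 0}"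

text \<open>Values of weight and length functions outside the carrier are never inspected.\<close>

definition Phi :: "('a, 'b) monoid_scheme \<Rightarrow> ('a \<Rightarrow> real) set" where
  "Phi G = {\<phi>. (\<forall>\<gamma>\<in>carrier G. 0 \<le> \<phi> \<gamma>) \<and> \<phi> \<one>\<^bsub>G\<^esub> = 0 \<and>
     (\<forall>\<gamma>\<in>carrier G. \<phi> (inv\<^bsub>G\<^esub> \<gamma>) = \<phi> \<gamma>) \<and>
     \<phi> summable_on carrier G \<and>
     generate G (supp G \<phi>) = carrier G}"

definition K_adj :: "('a, 'b) monoid_scheme \<Rightarrow> ('a \<Rightarrow> real) \<Rightarrow> 'a \<Rightarrow> 'a \<Rightarrow> bool" where
  "K_adj G \<phi> u v \<longleftrightarrow>
     u \<in> carrier G \<and> v \<in> carrier G \<and> inv\<^bsub>G\<^esub> u \<otimes>\<^bsub>G\<^esub> v \<in> supp G \<phi>"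

definition strong_graph_height_function ::
    "('a, 'b) monoid_scheme \<Rightarrow> ('a \<Rightarrow> real) \<Rightarrow> ('a \<Rightarrow> int) \<Rightarrow> 'a set \<Rightarrow> bool" where
  "strong_graph_height_function G \<phi> h H \<longleftrightarrow>
     h \<one>\<^bsub>G\<^esub> = 0 \<and>
     (\<forall>\<alpha>\<in>H. \<forall>u\<in>carrier G. \<forall>v\<in>carrier G.
        h (\<alpha> \<otimes>\<^bsub>G\<^esub> v) - h (\<alpha> \<otimes>\<^bsub>G\<^esub> u) = h v - h u) \<and>
     (\<forall>v\<in>carrier G. \<exists>u w. K_adj G \<phi> v u \<and> K_adj G \<phi> v w \<and> h u < h v \<and> h v < h w)"

definition Lambda :: "('a, 'b) monoid_scheme \<Rightarrow> ('a \<Rightarrow> real) set" where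
  "Lambda G = {l. (\<forall>\<gamma>\<in>carrier G. 0 < l \<gamma>) \<and>
     (\<forall>\<gamma>\<in>carrier G. l (inv\<^bsub>G\<^esub> \<gamma>) = l \<gamma>) \<and>
     0 < (INF \<gamma>\<in>carrier G. l \<gamma>)}"

definition Lambda_eps ::
    "('a, 'b) monoid_scheme \<Rightarrow> ('a \<Rightarrow> int) \<Rightarrow> real \<Rightarrow> real \<Rightarrow> ('a \<Rightarrow> real) \<Rightarrow> ('a \<Rightarrow> real) set" where
  "Lambda_eps G h \<epsilon> C \<phi> = {l \<in> Lambda G.
     \<forall>u\<in>carrier G. \<forall>v\<in>carrier G. \<phi> (inv\<^bsub>G\<^esub> u \<otimes>\<^bsub>G\<^esub> v) > 0 \<longrightarrow>
       real_of_int \<bar>h u - h v\<bar> \<le> C * l (inv\<^bsub>G\<^esub> u \<otimes>\<^bsub>G\<^esub> v) powr \<epsilon>}"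

text \<open>A walk with \<open>n\<close> steps is the list of its \<open>n + 1\<close> vertices; the graph is complete, so
  any list of distinct elements is a self-avoiding walk.\<close>

definition saws_from_id :: "('a, 'b) monoid_scheme \<Rightarrow> 'a list set" where
  "saws_from_id G = {\<pi>. \<pi> \<noteq> [] \<and> hd \<pi> = \<one>\<^bsub>G\<^esub> \<and> set \<pi> \<subseteq> carrier G \<and> distinct \<pi>}"

definition walk_weight :: "('a, 'b) monoid_scheme \<Rightarrow> ('a \<Rightarrow> real) \<Rightarrow> 'a list \<Rightarrow> real" where
  "walk_weight G \<phi> \<pi> = (\<Prod>i = 1..<length \<pi>. \<phi> (inv\<^bsub>G\<^esub> (\<pi> ! (i - 1)) \<otimes>\<^bsub>G\<^esub> \<pi> ! i))"

definition walk_length :: "('a, 'b) monoid_scheme \<Rightarrow> ('a \<Rightarrow> real) \<Rightarrow> 'a list \<Rightarrow> real" where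
  "walk_length G l \<pi> = (\<Sum>i = 1..<length \<pi>. l (inv\<^bsub>G\<^esub> (\<pi> ! (i - 1)) \<otimes>\<^bsub>G\<^esub> \<pi> ! i))"

definition saw_window ::
    "('a, 'b) monoid_scheme \<Rightarrow> ('a \<Rightarrow> real) \<Rightarrow> nat \<Rightarrow> real \<Rightarrow> 'a list set" where
  "saw_window G l m c =
     {\<pi> \<in> saws_from_id G. real m \<le> walk_length G l \<pi> \<and> walk_length G l \<pi> < real m + c}"

text \<open>The real-valued infinite sum takes no default value here: for \<open>\<phi>\<close> in \<open>Phi G\<close> and \<open>l\<close> in
  \<open>Lambda G\<close> the walks in a window have boundedly many steps, and the \<open>n\<close>-step walks have
  total weight at most the \<open>n\<close>-th power of the sum of \<open>\<phi>\<close>.\<close>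

definition window_connective_constant ::
    "('a, 'b) monoid_scheme \<Rightarrow> ('a \<Rightarrow> real) \<Rightarrow> ('a \<Rightarrow> real) \<Rightarrow> real \<Rightarrow> ereal" where
  "window_connective_constant G \<phi> l c =
     limsup (\<lambda>m. ereal ((\<Sum>\<^sub>\<infinity>\<pi>\<in>saw_window G l m c. walk_weight G \<phi> \<pi>) powr (1 / real m)))"

text \<open>The common value of the limsup for all sufficiently large window widths \<open>c\<close>.\<close>

definition connective_constant ::
    "('a, 'b) monoid_scheme \<Rightarrow> ('a \<Rightarrow> real) \<Rightarrow> ('a \<Rightarrow> real) \<Rightarrow> ereal" where
  "connective_constant G \<phi> l =
     (THE \<mu>. eventually (\<lambda>c. window_connective_constant G \<phi> l c = \<mu>) at_top)"

text \<open>The height function entering the length condition may depend on \<open>\<phi>\<close>, since \<open>K\<^sub>\<phi>\<close> does: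
  \<open>hF \<phi>\<close> is the one chosen for \<open>K\<^sub>\<phi>\<close>. In general no single function serves all
  \<open>\<phi>\<close> in \<open>Phi G\<close>.\<close>

definition Phi_Lambda_space ::
    "('a, 'b) monoid_scheme \<Rightarrow> (('a \<Rightarrow> real) \<Rightarrow> 'a \<Rightarrow> int) \<Rightarrow> real \<Rightarrow> real \<Rightarrow> real \<Rightarrow>
     (('a \<Rightarrow> real) \<times> ('a \<Rightarrow> real)) set" where
  "Phi_Lambda_space G hF \<epsilon> C W = {(\<phi>, l).
     \<phi> \<in> Phi G \<and> l \<in> Lambda_eps G (hF \<phi>) \<epsilon> C \<phi> \<and> connective_constant G \<phi> l \<le> ereal W}"

definition D_sup ::
    "('a, 'b) monoid_scheme \<Rightarrow> ('a \<Rightarrow> real) \<times> ('a \<Rightarrow> real) \<Rightarrow> ('a \<Rightarrow> real) \<times> ('a \<Rightarrow> real) \<Rightarrow> real" where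
  "D_sup G p q = (case p of (\<phi>, l1) \<Rightarrow> case q of (\<psi>, l2) \<Rightarrow>
     (SUP \<gamma>\<in>supp G \<phi> \<union> supp G \<psi>. \<bar>(\<phi> \<gamma> - \<psi> \<gamma>) / (\<phi> \<gamma> + \<psi> \<gamma>)\<bar>) +
     (SUP \<gamma>\<in>supp G \<phi> \<union> supp G \<psi>. \<bar>(l1 \<gamma> - l2 \<gamma>) / (l1 \<gamma> + l2 \<gamma>)\<bar>))"

end

theory Submission
  imports Defs
begin

text \<open>As for Cauchy--Hadamard, the connective constant is the infimum of those \<open>\<theta> > 0\<close> for which
  the series of \<open>w \<pi> * \<theta> powr - \<ell> \<pi>\<close> over all self-avoiding walks \<open>\<pi>\<close> converges; in particular it does
  not depend on the window width. The summand is a product over the steps of the walk, so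
  convergence can be compared step by step. If two pairs are close in \<open>D_sup\<close>, they have the same
  support, on which weights and lengths agree up to a factor near 1; as lengths are bounded away
  from 0, a slight increase of \<open>\<theta>\<close> absorbs both factors.\<close>

section \<open>Growth of window sums versus convergence of the tilted series\<close>

text \<open>In the m-th window \<open>\<theta> powr a \<pi>\<close> exceeds
  \<open>\<theta> ^ m\<close> by at most a constant factor, so a convergent tilted series bounds the
  window sum by \<open>K * \<theta> ^ m\<close> with \<open>K\<close> independent of m; the m-th
  root of \<open>K\<close> tends to 1.\<close>

lemma limsup_window_sum_le:
  fixes w a :: "'p \<Rightarrow> real" and c \<theta> :: real
  assumes w: "\<And>\<pi>. \<pi> \<in> S \<Longrightarrow> 0 \<le> w \<pi>" and \<theta>: "0 < \<theta>" and c: "0 \<le> c"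
    and sm: "(\<lambda>\<pi>. w \<pi> * \<theta> powr - a \<pi>) summable_on S"
  shows "limsup (\<lambda>m. ereal ((\<Sum>\<^sub>\<infinity>\<pi>\<in>{\<pi> \<in> S. real m \<le> a \<pi> \<and> a \<pi> < real m + c}. w \<pi>)
           powr (1 / real m))) \<le> ereal \<theta>"
proof -
  define T where "T = (\<Sum>\<^sub>\<infinity>\<pi>\<in>S. w \<pi> * \<theta> powr - a \<pi>)"
  \<comment> \<open>The maximum covers both \<theta> at least 1 and \<theta> below 1. Adding 1 to
    \<open>T\<close> keeps \<open>K\<close> positive even if all weights vanish, so that
    \<open>K powr 0\<close> is 1 and not 0.\<close>
  define K where "K = max 1 (\<theta> powr c) * (T + 1)"
  have "0 \<le> T"
    unfolding T_def by (rule infsum_nonneg) (simp add: w)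
  then have K: "0 < K"
    unfolding K_def by (intro mult_pos_pos) auto
  have powr_window: "\<theta> powr x \<le> max 1 (\<theta> powr c) * \<theta> powr m" if "m \<le> x" "x < m + c" for x m
  proof -
    have "\<theta> powr (x - m) \<le> max 1 (\<theta> powr c)"
    proof (cases "1 \<le> \<theta>")
      case True
      have "\<theta> powr (x - m) \<le> \<theta> powr c"
        by (rule powr_mono) (use that True in auto)
      then show ?thesis by simp
    next
      case False
      have "\<theta> powr (x - m) \<le> 1"
        by (rule powr_le1) (use that False \<theta> in auto)
      then show ?thesis by simp
    qed
    moreover have "\<theta> powr x = \<theta> powr (x - m) * \<theta> powr m"
      by (simp flip: powr_add)
    ultimately show ?thesis
      by (simp add: mult_right_mono)
  qed
  have le: "(\<Sum>\<^sub>\<infinity>\<pi>\<in>{\<pi> \<in> S. real m \<le> a \<pi> \<and> a \<pi> < real m + c}. w \<pi>) \<le> K * \<theta> ^ m" (is "infsum _ ?A \<le> _")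
    for m :: nat
  proof -
    let ?M = "max 1 (\<theta> powr c) * \<theta> powr real m"
    have smA: "(\<lambda>\<pi>. w \<pi> * \<theta> powr - a \<pi>) summable_on ?A"
      using sm by (rule summable_on_subset_banach) auto
    have pt: "w \<pi> \<le> ?M * (w \<pi> * \<theta> powr - a \<pi>)" if "\<pi> \<in> ?A" for \<pi>
    proof -
      have "w \<pi> = \<theta> powr a \<pi> * (w \<pi> * \<theta> powr - a \<pi>)"
        using \<theta> by (simp add: powr_minus)
      also have "\<dots> \<le> ?M * (w \<pi> * \<theta> powr - a \<pi>)"
        by (rule mult_right_mono) (use that powr_window w in auto)
      finally show ?thesis .
    qed
    have smM: "(\<lambda>\<pi>. ?M * (w \<pi> * \<theta> powr - a \<pi>)) summable_on ?A"
      by (rule summable_on_cmult_right[OF smA])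
    have "w summable_on ?A"
      by (rule summable_on_comparison_test[OF smM]) (use pt w in auto)
    then have "infsum w ?A \<le> (\<Sum>\<^sub>\<infinity>\<pi>\<in>?A. ?M * (w \<pi> * \<theta> powr - a \<pi>))"
      by (rule infsum_mono[OF _ smM pt])
    also have "\<dots> = ?M * (\<Sum>\<^sub>\<infinity>\<pi>\<in>?A. w \<pi> * \<theta> powr - a \<pi>)"
      by (rule infsum_cmult_right) (use smA in auto)
    also have "\<dots> \<le> ?M * T"
      unfolding T_def
      by (intro mult_left_mono infsum_mono_neutral smA sm) (use w in auto)
    also have "\<dots> \<le> ?M * (T + 1)"
      by (intro mult_left_mono) auto
    also have "\<dots> = K * \<theta> ^ m"
      using \<theta> by (simp add: K_def powr_realpow)
    finally show ?thesis .
  qed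
  \<comment> \<open>The index 0 has to be excluded: \<open>1 / real 0\<close> is 0, so the root
    would not undo the power.\<close>
  have "eventually (\<lambda>m. ereal ((\<Sum>\<^sub>\<infinity>\<pi>\<in>{\<pi> \<in> S. real m \<le> a \<pi> \<and> a \<pi> < real m + c}. w \<pi>) powr (1 / real m))
      \<le> ereal (K powr (1 / real m) * \<theta>)) sequentially"
    using eventually_gt_at_top[of "0::nat"]
  proof eventually_elim
    case (elim m)
    have "(\<Sum>\<^sub>\<infinity>\<pi>\<in>{\<pi> \<in> S. real m \<le> a \<pi> \<and> a \<pi> < real m + c}. w \<pi>) powr (1 / real m)
        \<le> (K * \<theta> ^ m) powr (1 / real m)"
      by (intro powr_mono2 le infsum_nonneg) (use w in auto)
    also have "\<dots> = K powr (1 / real m) * \<theta>"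
      using K \<theta> elim by (simp add: powr_mult powr_powr flip: powr_realpow)
    finally show ?case by simp
  qed
  then have "limsup (\<lambda>m. ereal ((\<Sum>\<^sub>\<infinity>\<pi>\<in>{\<pi> \<in> S. real m \<le> a \<pi> \<and> a \<pi> < real m + c}. w \<pi>) powr (1 / real m)))
      \<le> limsup (\<lambda>m. ereal (K powr (1 / real m) * \<theta>))"
    by (rule Limsup_mono)
  also have "(\<lambda>m. K powr (1 / real m) * \<theta>) \<longlonglongrightarrow> K powr 0 * \<theta>"
    using K by (intro tendsto_intros lim_1_over_n) auto
  then have "limsup (\<lambda>m. ereal (K powr (1 / real m) * \<theta>)) = ereal \<theta>"
    using K by (intro lim_imp_Limsup) auto
  finally show ?thesis .
qed

text \<open>This is the root test. Sort the walks by the integer part of \<open>a\<close>; as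
  \<open>c\<close> is at least 1, each unit block lies in its window, and the block sums are
  dominated by a geometric series. Assumption \<open>win\<close> makes the window sums meaningful,
  since \<open>infsum\<close> is 0 on families that are not summable.\<close>

lemma summable_if_limsup_window_sum_less:
  fixes w a :: "'p \<Rightarrow> real" and c \<theta> :: real
  assumes w: "\<And>\<pi>. \<pi> \<in> S \<Longrightarrow> 0 \<le> w \<pi>" and a: "\<And>\<pi>. \<pi> \<in> S \<Longrightarrow> 0 \<le> a \<pi>"
    and \<theta>: "0 < \<theta>" and c: "1 \<le> c"
    and win: "\<And>m::nat. w summable_on {\<pi> \<in> S. real m \<le> a \<pi> \<and> a \<pi> < real m + c}"
    and less: "limsup (\<lambda>m. ereal ((\<Sum>\<^sub>\<infinity>\<pi>\<in>{\<pi> \<in> S. real m \<le> a \<pi> \<and> a \<pi> < real m + c}. w \<pi>)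
           powr (1 / real m))) < ereal \<theta>"
  shows "(\<lambda>\<pi>. w \<pi> * \<theta> powr - a \<pi>) summable_on S"
proof -
  define A where "A m = {\<pi> \<in> S. real m \<le> a \<pi> \<and> a \<pi> < real m + c}" for m
  define Z where "Z m = infsum w (A m)" for m
  \<comment> \<open>Bounds \<open>\<theta> powr (real m - a \<pi>)\<close> on a unit block: the
    exponent lies between -1 and 0, and the worse end depends on whether \<theta> is below
    1.\<close>
  define K where "K = max 1 (\<theta> powr - 1)"
  have Z0: "0 \<le> Z m" for m
    unfolding Z_def A_def by (rule infsum_nonneg) (use w in auto)
  have "limsup (\<lambda>m. ereal (Z m powr (1 / real m))) < ereal \<theta>"
    using less by (simp add: Z_def A_def)
  then obtain r' where r': "limsup (\<lambda>m. ereal (Z m powr (1 / real m))) < r'" "r' < ereal \<theta>"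
    using dense by blast
  \<comment> \<open>A value strictly between a nonnegative limsup and a real number is itself a
    positive real; this allows \<open>r / \<theta>\<close> as the ratio of a convergent geometric
    series.\<close>
  have "(0::ereal) \<le> limsup (\<lambda>m. ereal (Z m powr (1 / real m)))"
    by (rule le_Limsup) auto
  then have "0 < r'"
    using r'(1) by (rule order.strict_trans1)
  with r' obtain r where r: "r' = ereal r" "0 < r" "r < \<theta>"
    by (cases r') auto
  have "eventually (\<lambda>m. ereal (Z m powr (1 / real m)) < ereal r) sequentially"
    using r'(1) r(1) Limsup_lessD by blast
  then have ev: "eventually (\<lambda>m. Z m \<le> r ^ m) sequentially"
    using eventually_gt_at_top[of "0::nat"]
  proof eventually_elim
    case (elim m)
    have "Z m = (Z m powr (1 / real m)) powr real m"
      using elim Z0[of m] by (simp add: powr_powr)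
    also have "\<dots> \<le> r powr real m"
      using elim by (intro powr_mono2) auto
    finally show ?case
      using r by (simp add: powr_realpow)
  qed
  define q where "q m = K * (Z m / \<theta> ^ m)" for m
  have K0: "0 \<le> K" unfolding K_def by simp
  have q0: "0 \<le> q m" for m
    unfolding q_def using Z0 K0 \<theta> by simp
  have "summable (\<lambda>m. (r / \<theta>) ^ m)"
    using r \<theta> by (intro summable_geometric) auto
  then have "summable (\<lambda>m. Z m / \<theta> ^ m)"
  proof (rule summable_comparison_test_ev[rotated])
    show "eventually (\<lambda>m. norm (Z m / \<theta> ^ m) \<le> (r / \<theta>) ^ m) sequentially"
      using ev
    proof eventually_elim
      case (elim m)
      then show ?case
        using Z0[of m] \<theta> by (simp add: power_divide divide_right_mono)
    qed
  qed
  then have q: "summable q"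
    unfolding q_def by (rule summable_mult)
  have block: "(\<Sum>\<pi>\<in>Y. w \<pi> * \<theta> powr - a \<pi>) \<le> q m"
    if Y: "finite Y" "Y \<subseteq> S" "\<And>\<pi>. \<pi> \<in> Y \<Longrightarrow> nat \<lfloor>a \<pi>\<rfloor> = m" for Y m
  proof -
    have fl: "real m \<le> a \<pi>" "a \<pi> < real m + 1" if "\<pi> \<in> Y" for \<pi>
    proof -
      have "\<lfloor>a \<pi>\<rfloor> = int m" using Y that a[of \<pi>] by force
      then show "real m \<le> a \<pi>" "a \<pi> < real m + 1" by linarith+
    qed
    have "\<theta> powr - a \<pi> \<le> K / \<theta> ^ m" if "\<pi> \<in> Y" for \<pi>
    proof -
      have "\<theta> powr (real m - a \<pi>) \<le> K"
      proof (cases "1 \<le> \<theta>")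
        case True
        have "\<theta> powr (real m - a \<pi>) \<le> \<theta> powr 0"
          by (rule powr_mono) (use fl[OF that] True in auto)
        then show ?thesis using \<theta> by (simp add: K_def)
      next
        case False
        have "\<theta> powr (real m - a \<pi>) \<le> \<theta> powr - 1"
          by (rule powr_mono') (use fl[OF that] False \<theta> in auto)
        then show ?thesis by (simp add: K_def)
      qed
      then show ?thesis
        using \<theta> by (simp add: powr_diff powr_minus powr_realpow field_simps)
    qed
    then have "(\<Sum>\<pi>\<in>Y. w \<pi> * \<theta> powr - a \<pi>) \<le> (\<Sum>\<pi>\<in>Y. w \<pi> * (K / \<theta> ^ m))"
      by (intro sum_mono mult_left_mono) (use Y w in auto)
    also have "\<dots> = K / \<theta> ^ m * sum w Y"
      by (simp add: sum_divide_distrib sum_distrib_left mult.commute)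
    also have "\<dots> \<le> K / \<theta> ^ m * Z m"
    proof (intro mult_left_mono)
      have "Y \<subseteq> A m"
        unfolding A_def using Y fl c by force
      then show "sum w Y \<le> Z m"
        unfolding Z_def
        by (intro finite_sum_le_infsum) (use Y win w in \<open>auto simp: A_def\<close>)
    qed (use K0 \<theta> in simp)
    finally show ?thesis by (simp add: q_def)
  qed
  show ?thesis
  proof (rule nonneg_bdd_above_summable_on)
    show "0 \<le> w \<pi> * \<theta> powr - a \<pi>" if "\<pi> \<in> S" for \<pi>
      using w that by simp
    show "bdd_above (sum (\<lambda>\<pi>. w \<pi> * \<theta> powr - a \<pi>) ` {Y. Y \<subseteq> S \<and> finite Y})"
    proof (rule bdd_aboveI2)
      fix Y assume Y: "Y \<in> {Y. Y \<subseteq> S \<and> finite Y}"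
      \<comment> \<open>Group a finite partial sum by integer parts of \<open>a\<close>; the
        resulting bound \<open>suminf q\<close> does not depend on \<open>Y\<close>.\<close>
      let ?n = "\<lambda>\<pi>. nat \<lfloor>a \<pi>\<rfloor>"
      have "(\<Sum>\<pi>\<in>Y. w \<pi> * \<theta> powr - a \<pi>)
          = (\<Sum>m\<in>?n ` Y. \<Sum>\<pi>\<in>{\<pi>\<in>Y. ?n \<pi> = m}. w \<pi> * \<theta> powr - a \<pi>)"
        using Y by (intro sum.image_gen) simp
      also have "\<dots> \<le> (\<Sum>m\<in>?n ` Y. q m)"
        by (intro sum_mono block) (use Y in auto)
      also have "\<dots> \<le> suminf q"
        by (intro sum_le_suminf q) (use Y q0 in auto)
      finally show "(\<Sum>\<pi>\<in>Y. w \<pi> * \<theta> powr - a \<pi>) \<le> suminf q" .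
    qed
  qed
qed

section \<open>Walks as words of increments, and a summability criterion\<close>

text \<open>Expanding the power by distributivity gives one term per word; the induction splits off
  the first letter.\<close>

lemma sum_prod_list_fixed_length:
  fixes f :: "'a \<Rightarrow> 'b::comm_semiring_1"
  assumes "finite B"
  shows "(\<Sum>xs | set xs \<subseteq> B \<and> length xs = n. prod_list (map f xs)) = sum f B ^ n"
proof (induction n)
  case 0
  have "{xs. set xs \<subseteq> B \<and> length xs = 0} = {[]}" by auto
  then show ?case by simp
next
  case (Suc n)
  let ?L = "\<lambda>n. {xs. set xs \<subseteq> B \<and> length xs = n}"
  have "?L (Suc n) = (\<lambda>(x, xs). x # xs) ` (B \<times> ?L n)"
    by (force simp: length_Suc_conv)
  moreover have "inj_on (\<lambda>(x, xs). x # xs) (B \<times> ?L n)"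
    by (auto intro: inj_onI)
  ultimately have "(\<Sum>xs\<in>?L (Suc n). prod_list (map f xs))
      = (\<Sum>(x, xs)\<in>B \<times> ?L n. f x * prod_list (map f xs))"
    by (simp add: sum.reindex case_prod_unfold)
  also have "\<dots> = sum f B * (\<Sum>xs\<in>?L n. prod_list (map f xs))"
    by (simp add: sum_product sum.cartesian_product)
  finally show ?case
    by (simp add: Suc.IH)
qed

text \<open>Weight and length of a walk depend only on its steps, so walks from the identity can be
  counted as words over the group.\<close>

definition increments :: "('a, 'b) monoid_scheme \<Rightarrow> 'a list \<Rightarrow> 'a list" where
  "increments G \<pi> = map (\<lambda>i. inv\<^bsub>G\<^esub> (\<pi> ! (i - 1)) \<otimes>\<^bsub>G\<^esub> \<pi> ! i) [1..<length \<pi>]"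

lemma length_increments: "length (increments G \<pi>) = length \<pi> - 1"
  by (simp add: increments_def)

lemma prod_list_increments: "prod_list (map f (increments G \<pi>)) = walk_weight G f \<pi>"
  unfolding increments_def walk_weight_def by (simp add: o_def flip: prod.distinct_set_conv_list)

lemma (in group) step_in_carrier:
  assumes "\<pi> \<in> saws_from_id G" and "i \<in> {1..<length \<pi>}"
  shows "inv (\<pi> ! (i - 1)) \<otimes> \<pi> ! i \<in> carrier G"
proof -
  have "\<pi> ! (i - 1) \<in> set \<pi>" "\<pi> ! i \<in> set \<pi>"
    using assms(2) by auto
  then show ?thesis
    using assms(1) by (auto simp: saws_from_id_def)
qed

lemma (in group) increments_in_carrier:
  "\<pi> \<in> saws_from_id G \<Longrightarrow> set (increments G \<pi>) \<subseteq> carrier G"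
  using step_in_carrier by (auto simp: increments_def)

text \<open>The common starting vertex and the steps recover all vertices in turn, by left
  cancellation.\<close>

lemma (in group) inj_on_increments: "inj_on (increments G) (saws_from_id G)"
proof (rule inj_onI)
  fix \<pi> \<rho>
  assume \<pi>: "\<pi> \<in> saws_from_id G" and \<rho>: "\<rho> \<in> saws_from_id G"
    and eq: "increments G \<pi> = increments G \<rho>"
  have len: "length \<pi> = length \<rho>"
    using arg_cong[OF eq, of length] \<pi> \<rho>
    by (cases \<pi>; cases \<rho>) (auto simp: length_increments saws_from_id_def)
  have mem: "\<pi> ! i \<in> carrier G" "\<rho> ! i \<in> carrier G" if "i < length \<pi>" for i
    using \<pi> \<rho> that len nth_mem[of i \<pi>] nth_mem[of i \<rho>] by (auto simp: saws_from_id_def)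
  have "\<pi> ! i = \<rho> ! i" if "i < length \<pi>" for i
    using that
  proof (induction i)
    case 0
    then show ?case
      using \<pi> \<rho> by (auto simp: saws_from_id_def hd_conv_nth)
  next
    case (Suc i)
    have "increments G \<pi> ! i = increments G \<rho> ! i"
      by (simp add: eq)
    then have "inv (\<pi> ! i) \<otimes> \<pi> ! Suc i = inv (\<rho> ! i) \<otimes> \<rho> ! Suc i"
      using Suc.prems len by (simp add: increments_def)
    then show ?case
      using Suc mem[of i] mem[of "Suc i"] by (metis Suc_lessD inv_closed l_cancel)
  qed
  then show "\<pi> = \<rho>"
    using len by (simp add: nth_equalityI)
qed

lemma (in group) walk_weight_nonneg:
  assumes "\<And>\<gamma>. \<gamma> \<in> carrier G \<Longrightarrow> 0 \<le> f \<gamma>" and "\<pi> \<in> saws_from_id G"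
  shows "0 \<le> walk_weight G f \<pi>"
  unfolding walk_weight_def using assms step_in_carrier by (intro prod_nonneg) auto

lemma (in group) walk_weight_mono:
  assumes "\<And>\<gamma>. \<gamma> \<in> carrier G \<Longrightarrow> 0 \<le> f \<gamma> \<and> f \<gamma> \<le> g \<gamma>" and "\<pi> \<in> saws_from_id G"
  shows "walk_weight G f \<pi> \<le> walk_weight G g \<pi>"
  unfolding walk_weight_def using assms step_in_carrier by (intro prod_mono) auto

text \<open>Walks inject into words, and the words with n letters have total weight at most the n-th
  power of \<open>infsum f (carrier G)\<close>; the geometric series does the rest.\<close>

lemma (in group) walk_weight_summable:
  assumes f: "\<And>\<gamma>. \<gamma> \<in> carrier G \<Longrightarrow> 0 \<le> f \<gamma>"
    and sm: "f summable_on carrier G" and less: "infsum f (carrier G) < 1"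
  shows "walk_weight G f summable_on saws_from_id G"
proof (rule nonneg_bdd_above_summable_on)
  show "0 \<le> walk_weight G f \<pi>" if "\<pi> \<in> saws_from_id G" for \<pi>
    using f that by (rule walk_weight_nonneg)
  let ?q = "infsum f (carrier G)"
  have q: "0 \<le> ?q"
    using f by (rule infsum_nonneg)
  show "bdd_above (sum (walk_weight G f) ` {Y. Y \<subseteq> saws_from_id G \<and> finite Y})"
  proof (rule bdd_aboveI2)
    fix Y assume "Y \<in> {Y. Y \<subseteq> saws_from_id G \<and> finite Y}"
    then have Y: "Y \<subseteq> saws_from_id G" "finite Y" by auto
    \<comment> \<open>Finitely many walks use finitely many letters and have bounded length, so only
      finite sums of words are involved.\<close>
    define B where "B = (\<Union>\<pi>\<in>Y. set (increments G \<pi>))"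
    define N where "N = Max (insert 0 (length ` increments G ` Y))"
    define L where "L n = {xs. set xs \<subseteq> B \<and> length xs = n}" for n
    have B: "finite B" "B \<subseteq> carrier G"
      using Y increments_in_carrier by (auto simp: B_def)
    have finL: "finite (L n)" for n
      unfolding L_def by (rule finite_lists_length_eq[OF B(1)])
    have "length (increments G \<pi>) \<le> N" if "\<pi> \<in> Y" for \<pi>
      unfolding N_def using that Y by (intro Max_ge) auto
    then have sub: "increments G ` Y \<subseteq> (\<Union>n\<le>N. L n)"
      by (auto simp: L_def B_def)
    have "sum (walk_weight G f) Y = (\<Sum>xs\<in>increments G ` Y. prod_list (map f xs))"
      using inj_on_subset[OF inj_on_increments Y(1)]
      by (simp add: sum.reindex prod_list_increments)
    also have "\<dots> \<le> (\<Sum>xs\<in>(\<Union>n\<le>N. L n). prod_list (map f xs))"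
    proof (rule sum_mono2)
      show "0 \<le> prod_list (map f xs)" if "xs \<in> (\<Union>n\<le>N. L n) - increments G ` Y" for xs
        using that B f by (intro prod_list_nonneg) (auto simp: L_def)
    qed (use finL sub in auto)
    also have "\<dots> = (\<Sum>n\<le>N. \<Sum>xs\<in>L n. prod_list (map f xs))"
      by (rule sum.UNION_disjoint) (use finL in \<open>auto simp: L_def\<close>)
    also have "\<dots> = (\<Sum>n\<le>N. sum f B ^ n)"
      unfolding L_def by (simp add: sum_prod_list_fixed_length[OF B(1)])
    also have "\<dots> \<le> (\<Sum>n\<le>N. ?q ^ n)"
      by (intro sum_mono power_mono finite_sum_le_infsum sm sum_nonneg) (use B f in auto)
    also have "\<dots> \<le> suminf (\<lambda>n. ?q ^ n)"
      by (intro sum_le_suminf summable_geometric) (use q less in auto)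
    finally show "sum (walk_weight G f) Y \<le> suminf (\<lambda>n. ?q ^ n)" .
  qed
qed

section \<open>Length-tilted weights and the connective constant\<close>

text \<open>Length is additive along the walk, so the exponential factor splits over the steps and
  the tilted series is again a series of walk weights.\<close>

lemma walk_weight_times_powr_length:
  assumes "0 < \<theta>"
  shows "walk_weight G \<phi> \<pi> * \<theta> powr - walk_length G l \<pi>
    = walk_weight G (\<lambda>\<gamma>. \<phi> \<gamma> * \<theta> powr - l \<gamma>) \<pi>"
  using assms
  by (simp add: walk_weight_def walk_length_def powr_sum prod.distrib flip: sum_negf)

text \<open>The real \<open>INF\<close> is a lower bound only on sets bounded below; positivity of
  \<open>l\<close> supplies that bound.\<close>

lemma Lambda_lower_bound:
  assumes "l \<in> Lambda G"
  obtains L where "0 < L" and "\<And>\<gamma>. \<gamma> \<in> carrier G \<Longrightarrow> L \<le> l \<gamma>"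
proof
  show "0 < (INF \<gamma>\<in>carrier G. l \<gamma>)"
    using assms by (simp add: Lambda_def)
  show "(INF \<gamma>\<in>carrier G. l \<gamma>) \<le> l \<gamma>" if "\<gamma> \<in> carrier G" for \<gamma>
    using that assms by (intro cINF_lower bdd_belowI2[where m=0]) (auto simp: Lambda_def less_imp_le)
qed

lemma (in group) walk_length_nonneg:
  assumes "l \<in> Lambda G" and "\<pi> \<in> saws_from_id G"
  shows "0 \<le> walk_length G l \<pi>"
  unfolding walk_length_def using assms step_in_carrier
  by (intro sum_nonneg) (force simp: Lambda_def less_imp_le)

lemma (in group) tilted_walk_weight_summable:
  assumes \<phi>: "\<phi> \<in> Phi G" and l: "l \<in> Lambda G"
  obtains \<theta> where "1 < \<theta>" and "walk_weight G (\<lambda>\<gamma>. \<phi> \<gamma> * \<theta> powr - l \<gamma>) summable_on saws_from_id G"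
proof -
  obtain L where L: "0 < L" "\<And>\<gamma>. \<gamma> \<in> carrier G \<Longrightarrow> L \<le> l \<gamma>"
    using Lambda_lower_bound[OF l] by blast
  have \<phi>0: "0 \<le> \<phi> \<gamma>" if "\<gamma> \<in> carrier G" for \<gamma>
    using \<phi> that by (simp add: Phi_def)
  have sm: "\<phi> summable_on carrier G"
    using \<phi> by (simp add: Phi_def)
  define T where "T = infsum \<phi> (carrier G)"
  have T: "0 \<le> T"
    unfolding T_def using \<phi>0 by (rule infsum_nonneg)
  \<comment> \<open>Chosen so that \<open>\<theta> powr - L\<close> is \<open>1 / (T + 2)\<close>,
    which brings the total tilted step weight below 1. With 2 rather than 1, \<theta> exceeds 1 even
    when \<open>T\<close> is 0.\<close>
  define \<theta> where "\<theta> = (T + 2) powr (1 / L)"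
  have \<theta>: "1 < \<theta>"
    unfolding \<theta>_def using T L by (intro gr_one_powr) auto
  have \<theta>L: "\<theta> powr - L = 1 / (T + 2)"
    using L T by (simp add: \<theta>_def powr_powr powr_minus_divide)
  let ?f = "\<lambda>\<gamma>. \<phi> \<gamma> * \<theta> powr - l \<gamma>"
  have le: "?f \<gamma> \<le> \<phi> \<gamma> * (1 / (T + 2))" if "\<gamma> \<in> carrier G" for \<gamma>
    unfolding \<theta>L[symmetric]
    by (intro mult_left_mono powr_mono) (use that L \<phi>0 \<theta> in auto)
  have sm': "(\<lambda>\<gamma>. \<phi> \<gamma> * (1 / (T + 2))) summable_on carrier G"
    using sm by (rule summable_on_cmult_left)
  have smf: "?f summable_on carrier G"
    by (rule summable_on_comparison_test[OF sm' le]) (use \<phi>0 in auto)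
  have "infsum ?f (carrier G) \<le> (\<Sum>\<^sub>\<infinity>\<gamma>\<in>carrier G. \<phi> \<gamma> * (1 / (T + 2)))"
    by (rule infsum_mono[OF smf sm' le])
  also have "\<dots> = T * (1 / (T + 2))"
    unfolding T_def by (rule infsum_cmult_left) (use sm in auto)
  also have "\<dots> < 1"
    using T by simp
  finally have "walk_weight G ?f summable_on saws_from_id G"
    by (intro walk_weight_summable smf) (use \<phi>0 in auto)
  with \<theta> show thesis by (rule that)
qed

text \<open>For every window width at least 1, the two window lemmas place the limsup at the same
  threshold of convergence. Hence the widths agree, and the definite description in
  \<open>connective_constant\<close> has a unique value.\<close>

lemma (in group) connective_constant_Cauchy_Hadamard:
  assumes \<phi>: "\<phi> \<in> Phi G" and l: "l \<in> Lambda G"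
  obtains \<mu> where "connective_constant G \<phi> l = ereal \<mu>" and "0 \<le> \<mu>"
    and "\<And>\<theta>. 0 < \<theta> \<Longrightarrow> walk_weight G (\<lambda>\<gamma>. \<phi> \<gamma> * \<theta> powr - l \<gamma>) summable_on saws_from_id G \<Longrightarrow> \<mu> \<le> \<theta>"
    and "\<And>\<theta>. \<mu> < \<theta> \<Longrightarrow> walk_weight G (\<lambda>\<gamma>. \<phi> \<gamma> * \<theta> powr - l \<gamma>) summable_on saws_from_id G"
proof -
  let ?sm = "\<lambda>\<theta>. walk_weight G (\<lambda>\<gamma>. \<phi> \<gamma> * \<theta> powr - l \<gamma>) summable_on saws_from_id G"
  let ?g = "window_connective_constant G \<phi> l"
  have \<phi>0: "0 \<le> \<phi> \<gamma>" if "\<gamma> \<in> carrier G" for \<gamma>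
    using \<phi> that by (simp add: Phi_def)
  note w0 = walk_weight_nonneg[of \<phi>, OF \<phi>0]
  have smeq: "?sm \<theta> \<longleftrightarrow> (\<lambda>\<pi>. walk_weight G \<phi> \<pi> * \<theta> powr - walk_length G l \<pi>) summable_on saws_from_id G"
    if "0 < \<theta>" for \<theta>
    using that by (simp add: walk_weight_times_powr_length)
  have up: "?g c \<le> ereal \<theta>" if "?sm \<theta>" "0 < \<theta>" "0 \<le> c" for \<theta> c
    unfolding window_connective_constant_def saw_window_def
    by (rule limsup_window_sum_le) (use that w0 smeq in auto)
  obtain \<theta>\<^sub>0 where \<theta>\<^sub>0: "1 < \<theta>\<^sub>0" "?sm \<theta>\<^sub>0"
    using tilted_walk_weight_summable[OF \<phi> l] .
  \<comment> \<open>Lengths are bounded on a window, so there the tilting factor at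
    \<open>\<theta>\<^sub>0\<close> is bounded away from 0 and can be removed.\<close>
  have win: "walk_weight G \<phi> summable_on {\<pi> \<in> saws_from_id G. real m \<le> walk_length G l \<pi> \<and> walk_length G l \<pi> < real m + c}"
    (is "_ summable_on ?A") for m :: nat and c
  proof -
    have "(\<lambda>\<pi>. walk_weight G \<phi> \<pi> * \<theta>\<^sub>0 powr - walk_length G l \<pi>) summable_on saws_from_id G"
      using \<theta>\<^sub>0 smeq[of \<theta>\<^sub>0] by simp
    then have "(\<lambda>\<pi>. walk_weight G \<phi> \<pi> * \<theta>\<^sub>0 powr - walk_length G l \<pi>) summable_on ?A"
      by (rule summable_on_subset_banach) auto
    then have sm: "(\<lambda>\<pi>. \<theta>\<^sub>0 powr (real m + c) * (walk_weight G \<phi> \<pi> * \<theta>\<^sub>0 powr - walk_length G l \<pi>)) summable_on ?A"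
      by (rule summable_on_cmult_right)
    show ?thesis
    proof (rule summable_on_comparison_test[OF sm])
      fix \<pi> assume \<pi>: "\<pi> \<in> ?A"
      have "walk_weight G \<phi> \<pi> = \<theta>\<^sub>0 powr walk_length G l \<pi> * (walk_weight G \<phi> \<pi> * \<theta>\<^sub>0 powr - walk_length G l \<pi>)"
        using \<theta>\<^sub>0 by (simp add: powr_minus)
      also have "\<dots> \<le> \<theta>\<^sub>0 powr (real m + c) * (walk_weight G \<phi> \<pi> * \<theta>\<^sub>0 powr - walk_length G l \<pi>)"
        by (intro mult_right_mono powr_mono) (use \<pi> \<theta>\<^sub>0 w0 in auto)
      finally show "walk_weight G \<phi> \<pi> \<le> \<theta>\<^sub>0 powr (real m + c) * (walk_weight G \<phi> \<pi> * \<theta>\<^sub>0 powr - walk_length G l \<pi>)" .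
    qed (use w0 in auto)
  qed
  have down: "?sm \<theta>" if "?g c < ereal \<theta>" "0 < \<theta>" "1 \<le> c" for \<theta> c
    unfolding smeq[OF \<open>0 < \<theta>\<close>]
    by (rule summable_if_limsup_window_sum_less[where c = c])
      (use that w0 win walk_length_nonneg[OF l] in \<open>auto simp: window_connective_constant_def saw_window_def\<close>)
  have g0: "0 \<le> ?g c" for c
    unfolding window_connective_constant_def by (rule le_Limsup) auto
  \<comment> \<open>A value strictly between the two constants would give convergence by
    \<open>down\<close> at width \<open>d\<close>, hence by \<open>up\<close> a contradictory bound
    at width \<open>c\<close>.\<close>
  have g_le: "?g c \<le> ?g d" if "1 \<le> c" "1 \<le> d" for c d
  proof (rule ccontr)
    assume "\<not> ?g c \<le> ?g d"
    then obtain z where z: "?g d < z" "z < ?g c"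
      using dense not_le by metis
    moreover have "0 < z"
      using g0 z(1) by (rule order.strict_trans1)
    ultimately obtain \<theta> where \<theta>: "z = ereal \<theta>" "0 < \<theta>"
      by (cases z) auto
    have "?sm \<theta>"
      using z(1) \<theta> that(2) by (intro down[of d]) auto
    then have "?g c \<le> z"
      unfolding \<theta>(1) using \<theta>(2) that(1) by (intro up) auto
    then show False
      using z(2) by (simp flip: not_le)
  qed
  have const: "?g c = ?g 1" if "1 \<le> c" for c
    using g_le that by (intro antisym) auto
  have cc: "connective_constant G \<phi> l = ?g 1"
    unfolding connective_constant_def
  proof (rule the_equality)
    show ev: "eventually (\<lambda>c. ?g c = ?g 1) at_top"
      using eventually_ge_at_top[of "1::real"] by eventually_elim (rule const)
    fix \<mu> assume "eventually (\<lambda>c. ?g c = \<mu>) at_top"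
    with ev have "eventually (\<lambda>c::real. ?g 1 = \<mu>) at_top"
      by eventually_elim simp
    then show "\<mu> = ?g 1" by simp
  qed
  \<comment> \<open>Convergence at \<open>\<theta>\<^sub>0\<close> rules out an infinite
    limsup.\<close>
  obtain \<mu> where \<mu>: "?g 1 = ereal \<mu>" "0 \<le> \<mu>"
    using up[OF \<theta>\<^sub>0(2), of 1] \<theta>\<^sub>0(1) g0[of 1] by (cases "?g 1") auto
  show thesis
  proof (rule that[of \<mu>])
    show "connective_constant G \<phi> l = ereal \<mu>"
      using cc \<mu>(1) by simp
    show "0 \<le> \<mu>"
      by (fact \<mu>(2))
    show "\<mu> \<le> \<theta>" if "0 < \<theta>" "?sm \<theta>" for \<theta>
      using up[OF that(2,1), of 1] \<mu>(1) by simp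
    show "?sm \<theta>" if "\<mu> < \<theta>" for \<theta>
      using that \<mu> by (intro down[of 1]) auto
  qed
qed

text \<open>Domination of tilted steps passes to products, so convergence carries over from one
  series to the other. The assumed bound is strict because convergence is guaranteed only strictly
  above the connective constant.\<close>

lemma (in group) connective_constant_stepwise_comparison:
  assumes "\<phi> \<in> Phi G" "l \<in> Lambda G" "\<psi> \<in> Phi G" "l' \<in> Lambda G"
    and less: "connective_constant G \<phi> l < ereal \<theta>" and pos: "0 < \<theta>'"
    and step: "\<And>\<gamma>. \<gamma> \<in> carrier G \<Longrightarrow> \<psi> \<gamma> * \<theta>' powr - l' \<gamma> \<le> \<phi> \<gamma> * \<theta> powr - l \<gamma>"
  shows "connective_constant G \<psi> l' \<le> ereal \<theta>'"
proof -
  have \<psi>0: "0 \<le> \<psi> \<gamma> * \<theta>' powr - l' \<gamma>" if "\<gamma> \<in> carrier G" for \<gamma>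
    using that assms(3) by (simp add: Phi_def)
  obtain \<mu> where \<mu>: "connective_constant G \<phi> l = ereal \<mu>"
      "\<And>\<theta>. \<mu> < \<theta> \<Longrightarrow> walk_weight G (\<lambda>\<gamma>. \<phi> \<gamma> * \<theta> powr - l \<gamma>) summable_on saws_from_id G"
    by (rule connective_constant_Cauchy_Hadamard[OF assms(1,2)]) blast
  obtain \<nu> where \<nu>: "connective_constant G \<psi> l' = ereal \<nu>"
      "\<And>\<theta>. 0 < \<theta> \<Longrightarrow> walk_weight G (\<lambda>\<gamma>. \<psi> \<gamma> * \<theta> powr - l' \<gamma>) summable_on saws_from_id G \<Longrightarrow> \<nu> \<le> \<theta>"
    by (rule connective_constant_Cauchy_Hadamard[OF assms(3,4)]) blast
  have "walk_weight G (\<lambda>\<gamma>. \<phi> \<gamma> * \<theta> powr - l \<gamma>) summable_on saws_from_id G"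
    using less by (intro \<mu>(2)) (simp add: \<mu>(1))
  then have "walk_weight G (\<lambda>\<gamma>. \<psi> \<gamma> * \<theta>' powr - l' \<gamma>) summable_on saws_from_id G"
    by (rule summable_on_comparison_test) (auto intro!: walk_weight_mono walk_weight_nonneg step \<psi>0)
  then show ?thesis
    using \<nu> pos by simp
qed

section \<open>Perturbation estimates and closeness in \<open>D_sup\<close>\<close>

text \<open>After taking logarithms the claim is that
  \<open>s * ln \<theta>' - t * ln \<theta>\<close> is at least \<open>ln \<kappa>\<close>. For
  \<open>s / t\<close> near 1 the left side is at least \<open>t\<close> times half the gap of the
  logarithms, and \<open>t\<close> at least \<open>L\<close> makes this exceed
  \<open>ln \<kappa>\<close>.\<close>

lemma powr_ratio_perturbation:
  fixes \<theta> \<theta>' L :: real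
  assumes "0 < \<theta>" "\<theta> < \<theta>'" "0 < L"
  obtains \<kappa>\<^sub>0 where "1 < \<kappa>\<^sub>0"
    and "\<And>\<kappa> s t. \<lbrakk>1 \<le> \<kappa>; \<kappa> < \<kappa>\<^sub>0; L \<le> t; t \<le> \<kappa> * s; s \<le> \<kappa> * t\<rbrakk> \<Longrightarrow>
           \<kappa> * \<theta>' powr - s \<le> \<theta> powr - t"
proof -
  define \<eta> where "\<eta> = ln \<theta>' - ln \<theta>"
  have \<eta>: "0 < \<eta>"
    using assms by (simp add: \<eta>_def)
  have lim: "filterlim (\<lambda>\<kappa>. \<kappa> * ln \<theta>' - ln \<theta>) (nhds (1 * ln \<theta>' - ln \<theta>)) (at_right 1)"
    "filterlim (\<lambda>\<kappa>. inverse \<kappa> * ln \<theta>' - ln \<theta>) (nhds (inverse 1 * ln \<theta>' - ln \<theta>)) (at_right 1)"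
    "filterlim ln (nhds (ln 1)) (at_right (1::real))"
    by (intro tendsto_intros; simp)+
  \<comment> \<open>The first bound serves negative \<open>ln \<theta>'\<close>, where
    \<open>s\<close> is largest at worst; the second serves nonnegative \<open>ln \<theta>'\<close>,
    where \<open>s\<close> is smallest at worst.\<close>
  have "\<forall>\<^sub>F \<kappa> in at_right 1. \<eta> / 2 < \<kappa> * ln \<theta>' - ln \<theta> \<and> \<eta> / 2 < inverse \<kappa> * ln \<theta>' - ln \<theta> \<and> ln \<kappa> < L * (\<eta> / 2)"
    by (intro eventually_conj order_tendstoD(1)[OF lim(1)] order_tendstoD(1)[OF lim(2)] order_tendstoD(2)[OF lim(3)])
      (use \<eta> assms in \<open>auto simp: \<eta>_def\<close>)
  then obtain \<kappa>\<^sub>0 where \<kappa>\<^sub>0: "1 < \<kappa>\<^sub>0" "\<And>\<kappa>. 1 < \<kappa> \<Longrightarrow> \<kappa> < \<kappa>\<^sub>0 \<Longrightarrow>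
      \<eta> / 2 < \<kappa> * ln \<theta>' - ln \<theta> \<and> \<eta> / 2 < inverse \<kappa> * ln \<theta>' - ln \<theta> \<and> ln \<kappa> < L * (\<eta> / 2)"
    unfolding eventually_at_right_field by auto
  show thesis
  proof (rule that[OF \<kappa>\<^sub>0(1)])
    fix \<kappa> s t
    assume \<kappa>: "1 \<le> \<kappa>" "\<kappa> < \<kappa>\<^sub>0" and t: "L \<le> t" "t \<le> \<kappa> * s" "s \<le> \<kappa> * t"
    \<comment> \<open>The filter says nothing at \<kappa> = 1 itself, which is checked
      separately.\<close>
    have bd: "\<eta> / 2 \<le> \<kappa> * ln \<theta>' - ln \<theta>" "\<eta> / 2 \<le> inverse \<kappa> * ln \<theta>' - ln \<theta>" "ln \<kappa> \<le> L * (\<eta> / 2)"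
      using \<kappa>\<^sub>0(2)[of \<kappa>] \<kappa> \<eta> assms by (cases "\<kappa> = 1"; fastforce simp: \<eta>_def)+
    have t0: "0 < t" using t assms by simp
    have s: "t * inverse \<kappa> \<le> s"
      using t \<kappa> by (simp add: field_simps)
    have "t * (\<eta> / 2) \<le> s * ln \<theta>' - t * ln \<theta>"
    proof (cases "0 \<le> ln \<theta>'")
      case True
      have "t * (\<eta> / 2) \<le> t * (inverse \<kappa> * ln \<theta>' - ln \<theta>)"
        using bd t0 by (intro mult_left_mono) auto
      also have "\<dots> \<le> s * ln \<theta>' - t * ln \<theta>"
        using mult_right_mono[OF s True] by (simp add: algebra_simps)
      finally show ?thesis .
    next
      case False
      have "t * (\<eta> / 2) \<le> t * (\<kappa> * ln \<theta>' - ln \<theta>)"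
        using bd t0 by (intro mult_left_mono) auto
      also have "\<dots> \<le> s * ln \<theta>' - t * ln \<theta>"
        using mult_right_mono_neg[OF t(3), of "ln \<theta>'"] False by (simp add: algebra_simps)
      finally show ?thesis .
    qed
    moreover have "ln \<kappa> \<le> t * (\<eta> / 2)"
      using bd(3) mult_right_mono[OF t(1), of "\<eta> / 2"] \<eta> by linarith
    ultimately have "ln \<kappa> - s * ln \<theta>' \<le> - t * ln \<theta>"
      by simp
    then have "exp (ln \<kappa> + - s * ln \<theta>') \<le> exp (- t * ln \<theta>)"
      by simp
    then show "\<kappa> * \<theta>' powr - s \<le> \<theta> powr - t"
      using \<kappa> assms by (simp add: powr_def exp_add exp_diff exp_minus field_simps)
  qed
qed

text \<open>Solving \<open>x - y \<le> d * (x + y)\<close> for \<open>x\<close> produces the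
  factor.\<close>

lemma ratio_le_if_relative_difference_less:
  fixes x y d :: real
  assumes "0 \<le> x" "0 \<le> y" "0 < x + y" "\<bar>(x - y) / (x + y)\<bar> < d" "d < 1"
  shows "x \<le> (1 + d) / (1 - d) * y"
proof -
  have "\<bar>x - y\<bar> < d * (x + y)"
    using assms by (simp add: field_simps)
  then have "x - y \<le> d * (x + y)"
    by linarith
  then show ?thesis
    using assms by (simp add: field_simps)
qed

text \<open>A real \<open>SUP\<close> dominates its terms only on bounded sets; the relative
  difference of nonnegative numbers is at most 1 in absolute value.\<close>

lemma D_sup_less_imp:
  assumes \<phi>: "\<And>\<gamma>. \<gamma> \<in> carrier G \<Longrightarrow> 0 \<le> \<phi> \<gamma>" and \<psi>: "\<And>\<gamma>. \<gamma> \<in> carrier G \<Longrightarrow> 0 \<le> \<psi> \<gamma>"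
    and l: "\<And>\<gamma>. \<gamma> \<in> carrier G \<Longrightarrow> 0 < l \<gamma>" and l': "\<And>\<gamma>. \<gamma> \<in> carrier G \<Longrightarrow> 0 < l' \<gamma>"
    and D: "D_sup G (\<phi>, l) (\<psi>, l') < d" and \<gamma>: "\<gamma> \<in> supp G \<phi> \<union> supp G \<psi>"
  shows "\<bar>(\<phi> \<gamma> - \<psi> \<gamma>) / (\<phi> \<gamma> + \<psi> \<gamma>)\<bar> < d" and "\<bar>(l \<gamma> - l' \<gamma>) / (l \<gamma> + l' \<gamma>)\<bar> < d"
proof -
  let ?U = "supp G \<phi> \<union> supp G \<psi>"
  let ?f = "\<lambda>\<gamma>. \<bar>(\<phi> \<gamma> - \<psi> \<gamma>) / (\<phi> \<gamma> + \<psi> \<gamma>)\<bar>" and ?g = "\<lambda>\<gamma>. \<bar>(l \<gamma> - l' \<gamma>) / (l \<gamma> + l' \<gamma>)\<bar>"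
  have ratio: "\<bar>(x - y) / (x + y)\<bar> \<le> 1" if "0 \<le> x" "0 \<le> y" for x y :: real
    using that by (auto simp: divide_le_eq_1)
  have "bdd_above (?f ` ?U)"
    by (rule bdd_aboveI2[where M = 1], rule ratio) (use \<phi> \<psi> in \<open>auto simp: supp_def\<close>)
  moreover have "bdd_above (?g ` ?U)"
    by (rule bdd_aboveI2[where M = 1], rule ratio) (use l l' in \<open>auto simp: supp_def less_imp_le\<close>)
  ultimately have "?f \<gamma> \<le> (SUP \<gamma>\<in>?U. ?f \<gamma>)" "?g \<gamma> \<le> (SUP \<gamma>\<in>?U. ?g \<gamma>)"
    using \<gamma> by (auto intro: cSUP_upper)
  moreover have "(SUP \<gamma>\<in>?U. ?f \<gamma>) + (SUP \<gamma>\<in>?U. ?g \<gamma>) < d"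
    using D by (simp add: D_sup_def)
  moreover have "0 \<le> ?f \<gamma>" "0 \<le> ?g \<gamma>" by auto
  ultimately show "?f \<gamma> < d" "?g \<gamma> < d" by linarith+
qed

text \<open>Relative differences are symmetric, so bounds hold both ways. Off both supports
  \<open>D_sup\<close> carries no information, hence the positivity condition on \<gamma>.\<close>

lemma D_sup_less_imp_comparable:
  fixes d
  defines "\<kappa> \<equiv> (1 + d) / (1 - d)"
  assumes \<phi>: "\<phi> \<in> Phi G" and \<psi>: "\<psi> \<in> Phi G" and l: "l \<in> Lambda G" and l': "l' \<in> Lambda G"
    and D: "D_sup G (\<phi>, l) (\<psi>, l') < d" and d: "d < 1" and \<gamma>: "\<gamma> \<in> carrier G" "\<phi> \<gamma> > 0 \<or> \<psi> \<gamma> > 0"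
  shows "\<phi> \<gamma> \<le> \<kappa> * \<psi> \<gamma>" "\<psi> \<gamma> \<le> \<kappa> * \<phi> \<gamma>" "l \<gamma> \<le> \<kappa> * l' \<gamma>" "l' \<gamma> \<le> \<kappa> * l \<gamma>"
proof -
  have nn: "0 \<le> \<phi> \<gamma>" "0 \<le> \<psi> \<gamma>" "0 < l \<gamma>" "0 < l' \<gamma>" if "\<gamma> \<in> carrier G" for \<gamma>
    using \<phi> \<psi> l l' that by (auto simp: Phi_def Lambda_def)
  have "\<gamma> \<in> supp G \<phi> \<union> supp G \<psi>"
    using \<gamma> by (auto simp: supp_def)
  have *: "\<bar>(\<phi> \<gamma> - \<psi> \<gamma>) / (\<phi> \<gamma> + \<psi> \<gamma>)\<bar> < d" "\<bar>(l \<gamma> - l' \<gamma>) / (l \<gamma> + l' \<gamma>)\<bar> < d"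
    by (rule D_sup_less_imp[where l = l and l' = l' and \<phi> = \<phi> and \<psi> = \<psi> and G = G]; use nn D \<open>\<gamma> \<in> supp G \<phi> \<union> supp G \<psi>\<close> in blast)+
  then have **: "\<bar>(\<psi> \<gamma> - \<phi> \<gamma>) / (\<psi> \<gamma> + \<phi> \<gamma>)\<bar> < d" "\<bar>(l' \<gamma> - l \<gamma>) / (l' \<gamma> + l \<gamma>)\<bar> < d"
    by (simp_all add: abs_minus_commute add.commute)
  show "\<phi> \<gamma> \<le> \<kappa> * \<psi> \<gamma>" "\<psi> \<gamma> \<le> \<kappa> * \<phi> \<gamma>" "l \<gamma> \<le> \<kappa> * l' \<gamma>" "l' \<gamma> \<le> \<kappa> * l \<gamma>"
    unfolding \<kappa>_def
    by (rule ratio_le_if_relative_difference_less; use * ** nn[OF \<gamma>(1)] \<gamma>(2) d in linarith)+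
qed

section \<open>Continuity of the connective constant\<close>

theorem theorem4p1:
  fixes G :: "('a, 'b) monoid_scheme" and H :: "'a set" and F :: "'a \<Rightarrow> int"
    and hF :: "('a \<Rightarrow> real) \<Rightarrow> 'a \<Rightarrow> int" and C W \<epsilon> :: real
  assumes "group G" and "finitely_generated G" and "virtually_indicable G H F"
    and "\<And>\<phi>. \<phi> \<in> Phi G \<Longrightarrow> strong_graph_height_function G \<phi> (hF \<phi>) H"
    and "C > 0" and "W > 0" and "1 \<le> \<epsilon>" and "\<epsilon> < 2"
  shows "\<forall>p \<in> Phi_Lambda_space G hF \<epsilon> C W. \<forall>e > 0. \<exists>d > 0.
           \<forall>q \<in> Phi_Lambda_space G hF \<epsilon> C W. D_sup G p q < d \<longrightarrow>
             \<bar>connective_constant G (fst q) (snd q) - connective_constant G (fst p) (snd p)\<bar>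
               < ereal e"
proof (intro ballI allI impI)
  interpret group G by fact
  fix p and e :: real
  assume p: "p \<in> Phi_Lambda_space G hF \<epsilon> C W" and e: "0 < e"
  obtain \<phi> l where pq: "p = (\<phi>, l)" by fastforce
  have \<phi>: "\<phi> \<in> Phi G" and l: "l \<in> Lambda G"
    using p by (auto simp: pq Phi_Lambda_space_def Lambda_eps_def)
  obtain L where L: "0 < L" "\<And>\<gamma>. \<gamma> \<in> carrier G \<Longrightarrow> L \<le> l \<gamma>"
    using Lambda_lower_bound[OF l] by blast
  obtain \<mu> where \<mu>: "connective_constant G \<phi> l = ereal \<mu>" "0 \<le> \<mu>"
    by (rule connective_constant_Cauchy_Hadamard[OF \<phi> l])
  \<comment> \<open>For the upper bound on the nearby constant: one third of \<open>e\<close> makes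
    the assumed bound strict, the second absorbs the perturbation, the third makes the conclusion
    strict.\<close>
  obtain \<kappa>\<^sub>1 where \<kappa>\<^sub>1: "1 < \<kappa>\<^sub>1" "\<And>\<kappa> s t. \<lbrakk>1 \<le> \<kappa>; \<kappa> < \<kappa>\<^sub>1; L \<le> t; t \<le> \<kappa> * s; s \<le> \<kappa> * t\<rbrakk> \<Longrightarrow>
      \<kappa> * (\<mu> + 2 * e / 3) powr - s \<le> (\<mu> + e / 3) powr - t"
    by (rule powr_ratio_perturbation[of "\<mu> + e / 3" "\<mu> + 2 * e / 3" L]) (use \<mu> e L in auto)
  \<comment> \<open>For the reversed comparison. The nearby lengths have only the lower bound
    \<open>L / 2\<close>, which follows from a factor below 2. If \<open>e\<close> exceeds \<mu>,
    the base \<open>\<mu> - 2 * e / 3\<close> need not be positive, but nothing is asked and any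
    witness above 1 will do.\<close>
  obtain \<kappa>\<^sub>2 where \<kappa>\<^sub>2: "1 < \<kappa>\<^sub>2" "\<And>\<kappa> s t. \<lbrakk>e \<le> \<mu>; 1 \<le> \<kappa>; \<kappa> < \<kappa>\<^sub>2; L / 2 \<le> t; t \<le> \<kappa> * s; s \<le> \<kappa> * t\<rbrakk> \<Longrightarrow>
      \<kappa> * (\<mu> - e / 3) powr - s \<le> (\<mu> - 2 * e / 3) powr - t"
  proof (cases "e \<le> \<mu>")
    case True
    then show ?thesis
      by (rule_tac powr_ratio_perturbation[of "\<mu> - 2 * e / 3" "\<mu> - e / 3" "L / 2"]) (use that e L in auto)
  next
    case False
    then show ?thesis using that[of 2] by auto
  qed
  \<comment> \<open>The comparison factor tends to 1 with \<open>d\<close>, so it falls below all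
    three thresholds.\<close>
  have "filterlim (\<lambda>d::real. (1 + d) / (1 - d)) (nhds ((1 + 0) / (1 - 0))) (at_right 0)"
    by (intro tendsto_intros) auto
  then have "\<forall>\<^sub>F d in at_right (0::real). (1 + d) / (1 - d) < min 2 (min \<kappa>\<^sub>1 \<kappa>\<^sub>2)"
    using \<kappa>\<^sub>1(1) \<kappa>\<^sub>2(1) by (intro order_tendstoD(2)) auto
  moreover have "\<forall>\<^sub>F d in at_right (0::real). d \<in> {0<..<1}"
    by (rule eventually_at_right_real) simp
  ultimately have "\<forall>\<^sub>F d in at_right (0::real). (1 + d) / (1 - d) < min 2 (min \<kappa>\<^sub>1 \<kappa>\<^sub>2) \<and> d \<in> {0<..<1}"
    by (rule eventually_conj)
  then have "\<exists>d::real. (1 + d) / (1 - d) < min 2 (min \<kappa>\<^sub>1 \<kappa>\<^sub>2) \<and> d \<in> {0<..<1}"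
    by (rule eventually_happens'[rotated]) simp
  then obtain d :: real where d: "0 < d" "d < 1" "(1 + d) / (1 - d) < min 2 (min \<kappa>\<^sub>1 \<kappa>\<^sub>2)"
    unfolding greaterThanLessThan_iff by blast
  define \<kappa> where "\<kappa> = (1 + d) / (1 - d)"
  have \<kappa>: "1 \<le> \<kappa>" "\<kappa> < 2" "\<kappa> < \<kappa>\<^sub>1" "\<kappa> < \<kappa>\<^sub>2"
    using d by (auto simp: \<kappa>_def)
  show "\<exists>d>0. \<forall>q\<in>Phi_Lambda_space G hF \<epsilon> C W. D_sup G p q < d \<longrightarrow>
      \<bar>connective_constant G (fst q) (snd q) - connective_constant G (fst p) (snd p)\<bar> < ereal e"
  proof (intro exI[of _ d] conjI ballI impI d(1))
    fix q assume q: "q \<in> Phi_Lambda_space G hF \<epsilon> C W" and D: "D_sup G p q < d"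
    obtain \<psi> l' where qq: "q = (\<psi>, l')" by fastforce
    have \<psi>: "\<psi> \<in> Phi G" and l': "l' \<in> Lambda G"
      using q by (auto simp: qq Phi_Lambda_space_def Lambda_eps_def)
    note cmp = D_sup_less_imp_comparable[OF \<phi> \<psi> l l' D[unfolded pq qq] d(2), folded \<kappa>_def]
    have nn: "0 \<le> \<phi> \<gamma>" "0 \<le> \<psi> \<gamma>" if "\<gamma> \<in> carrier G" for \<gamma>
      using \<phi> \<psi> that by (auto simp: Phi_def)
    obtain \<nu> where \<nu>: "connective_constant G \<psi> l' = ereal \<nu>" "0 \<le> \<nu>"
      by (rule connective_constant_Cauchy_Hadamard[OF \<psi> l'])
    have "connective_constant G \<psi> l' \<le> ereal (\<mu> + 2 * e / 3)"
    proof (rule connective_constant_stepwise_comparison[OF \<phi> l \<psi> l', where \<theta> = "\<mu> + e / 3"])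
      fix \<gamma> assume \<gamma>: "\<gamma> \<in> carrier G"
      show "\<psi> \<gamma> * (\<mu> + 2 * e / 3) powr - l' \<gamma> \<le> \<phi> \<gamma> * (\<mu> + e / 3) powr - l \<gamma>"
      \<comment> \<open>Where both weights vanish, both sides are 0 and the lengths do not
        matter.\<close>
      proof (cases "0 < \<phi> \<gamma> \<or> 0 < \<psi> \<gamma>")
        case True
        note c = cmp[OF \<gamma> True]
        have "\<psi> \<gamma> * (\<mu> + 2 * e / 3) powr - l' \<gamma> \<le> \<phi> \<gamma> * (\<kappa> * (\<mu> + 2 * e / 3) powr - l' \<gamma>)"
          using mult_right_mono[OF c(2), of "(\<mu> + 2 * e / 3) powr - l' \<gamma>"] by (simp add: mult_ac)
        also have "\<dots> \<le> \<phi> \<gamma> * (\<mu> + e / 3) powr - l \<gamma>"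
          by (intro mult_left_mono \<kappa>\<^sub>1(2)) (use \<kappa> c L \<gamma> nn in auto)
        finally show ?thesis .
      qed (use nn[OF \<gamma>] in auto)
    qed (use \<mu> e in auto)
    \<comment> \<open>Otherwise \<nu> lies below \<open>\<mu> - 2 * e / 3\<close>, and comparing
      with exchanged roles bounds \<mu> by \<open>\<mu> - e / 3\<close>. The case
      \<open>e \<le> \<mu>\<close> is automatic here, as \<nu> is nonnegative.\<close>
    moreover have "\<mu> - e < \<nu>"
    proof (rule ccontr)
      assume "\<not> \<mu> - e < \<nu>"
      then have le: "\<nu> \<le> \<mu> - e" by simp
      have "connective_constant G \<phi> l \<le> ereal (\<mu> - e / 3)"
      proof (rule connective_constant_stepwise_comparison[OF \<psi> l' \<phi> l, where \<theta> = "\<mu> - 2 * e / 3"])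
        fix \<gamma> assume \<gamma>: "\<gamma> \<in> carrier G"
        show "\<phi> \<gamma> * (\<mu> - e / 3) powr - l \<gamma> \<le> \<psi> \<gamma> * (\<mu> - 2 * e / 3) powr - l' \<gamma>"
        proof (cases "0 < \<phi> \<gamma> \<or> 0 < \<psi> \<gamma>")
          case True
          note c = cmp[OF \<gamma> True]
          have "0 < l' \<gamma>" using l' \<gamma> by (auto simp: Lambda_def)
          then have "\<kappa> * l' \<gamma> \<le> 2 * l' \<gamma>"
            using \<kappa> by (intro mult_right_mono) auto
          then have L': "L / 2 \<le> l' \<gamma>"
            using c(3) L(2)[OF \<gamma>] by simp
          have "\<phi> \<gamma> * (\<mu> - e / 3) powr - l \<gamma> \<le> \<psi> \<gamma> * (\<kappa> * (\<mu> - e / 3) powr - l \<gamma>)"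
            using mult_right_mono[OF c(1), of "(\<mu> - e / 3) powr - l \<gamma>"] by (simp add: mult_ac)
          also have "\<dots> \<le> \<psi> \<gamma> * (\<mu> - 2 * e / 3) powr - l' \<gamma>"
            by (intro mult_left_mono \<kappa>\<^sub>2(2)) (use \<kappa> c L' \<gamma> nn le \<nu> in auto)
          finally show ?thesis .
        qed (use nn[OF \<gamma>] in auto)
      qed (use \<nu> e le in auto)
      then show False
        using \<mu> e by simp
    qed
    ultimately show "\<bar>connective_constant G (fst q) (snd q) - connective_constant G (fst p) (snd p)\<bar> < ereal e"
      using \<mu> \<nu> e by (auto simp: pq qq)
  qed
qed

end
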